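(* Let $n,m\ge 1$ and let $\mathbf{x}_1,\dots,\mathbf{x}_n$ be pairwise uncorrelated random vectors in $\mathbb{R}^m$, where $\mathbf{x}_i$ has mean $\boldsymbol{\mu}_i$ and invertible covariance matrix $\Sigma_i$. For real $m\times m$ matrices $A=(A_1,\dots,A_n)$ with $\sum_{i=1}^n A_i=I$, consider the linear estimator $\mathbf{y}_A(\mathbf{x}_1,\dots,\mathbf{x}_n)=\sum_{i=1}^n A_i\mathbf{x}_i$. Then, among all such $A$, the value of $MSE(\mathbf{y}_A)$ is minimized for $$A_i=\Big(\sum_{j=1}^n\Sigma_j^{-1}\Big)^{-1}\Sigma_i^{-1}\qquad(1\le i\le n).$$
   Context: The covariance matrix of a random vector $\mathbf{x}$ with mean $\boldsymbol{\mu}$ is $E[(\mathbf{x}-\boldsymbol{\mu})(\mathbf{x}-\boldsymbol{\mu})^{T}]$. Random vectors $\mathbf{v},\mathbf{w}$ with means $\boldsymbol{\mu}_{\mathbf v},\boldsymbol{\mu}_{\mathbf w}$ are uncorrelated if the cross-covariance matrix $E[(\mathbf{v}-\boldsymbol{\mu}_{\mathbf v})(\mathbf{w}-\boldsymbol{\mu}_{\mathbf w})^{T}]$ is zero. For a linear estimator $\mathbf{y}$ with mean $\boldsymbol{\mu}_{\mathbf y}$, $MSE(\mathbf{y})=E[(\mathbf{y}-\boldsymbol{\mu}_{\mathbf y})^{T}(\mathbf{y}-\boldsymbol{\mu}_{\mathbf y})]$, equivalently the trace of the covariance matrix of $\mathbf{y}$. The means $\boldsymbol{\mu}_i$ are not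 assumed equal. *)

theory Defs
  imports "HOL-Probability.Probability"
begin

text \<open>
  The relations below use \<^const>\<open>has_bochner_integral\<close>, so that "has mean" and "has covariance
  matrix" include the existence of the expectation; the value of
  \<^const>\<open>lebesgue_integral\<close> alone is 0 for a non-integrable function.
\<close>

definition has_mean :: "'a measure \<Rightarrow> ('a \<Rightarrow> real ^ 'm) \<Rightarrow> real ^ 'm \<Rightarrow> bool" where
  "has_mean M x \<mu> \<longleftrightarrow> has_bochner_integral M x \<mu>"

text \<open>The matrix $v w^T$.\<close>

definition outer_product :: "real ^ 'm \<Rightarrow> real ^ 'k \<Rightarrow> real ^ 'k ^ 'm" where
  "outer_product v w = (\<chi> i j. v $ i * w $ j)"

definition has_cross_covariance ::
  "'a measure \<Rightarrow> ('a \<Rightarrow> real ^ 'm) \<Rightarrow> ('a \<Rightarrow> real ^ 'k) \<Rightarrow> real ^ 'k ^ 'm \<Rightarrow> bool" where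
  "has_cross_covariance M v w C \<longleftrightarrow>
     has_bochner_integral M
       (\<lambda>\<omega>. outer_product (v \<omega> - integral\<^sup>L M v) (w \<omega> - integral\<^sup>L M w)) C"

definition has_covariance :: "'a measure \<Rightarrow> ('a \<Rightarrow> real ^ 'm) \<Rightarrow> real ^ 'm ^ 'm \<Rightarrow> bool" where
  "has_covariance M x S \<longleftrightarrow> has_cross_covariance M x x S"

definition uncorrelated ::
  "'a measure \<Rightarrow> ('a \<Rightarrow> real ^ 'm) \<Rightarrow> ('a \<Rightarrow> real ^ 'k) \<Rightarrow> bool" where
  "uncorrelated M v w \<longleftrightarrow> has_cross_covariance M v w 0"

definition MSE :: "'a measure \<Rightarrow> ('a \<Rightarrow> real ^ 'm) \<Rightarrow> real" where
  "MSE M y = (LINT \<omega>|M. (y \<omega> - integral\<^sup>L M y) \<bullet> (y \<omega> - integral\<^sup>L M y))"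

definition linear_estimator ::
  "nat \<Rightarrow> (nat \<Rightarrow> real ^ 'm ^ 'm) \<Rightarrow> (nat \<Rightarrow> 'a \<Rightarrow> real ^ 'm) \<Rightarrow> 'a \<Rightarrow> real ^ 'm" where
  "linear_estimator n A x \<omega> = (\<Sum>i=1..n. A i *v x i \<omega>)"

end

theory Submission
  imports Defs
begin

text \<open>
  By uncorrelatedness the mean square error of an estimator is
  $\sum_i \mathrm{tr}(A_i \Sigma_i A_i^T)$, a convex quadratic function of $A$. At the candidate
  $A_0$ the products $A_{0,i} \Sigma_i$ all equal $P^{-1}$ with $P = \sum_j \Sigma_j^{-1}$, so the
  term linear in $D = A - A_0$ is $2\,\mathrm{tr}(P^{-1} (\sum_i D_i)^T) = 0$, and the quadratic term
  $\sum_i \mathrm{tr}(D_i \Sigma_i D_i^T)$ is nonnegative.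
\<close>

lemma matrix_inv_left: "invertible A \<Longrightarrow> matrix_inv A ** A = mat 1"
  and matrix_inv_right: "invertible A \<Longrightarrow> A ** matrix_inv A = mat 1"
  unfolding invertible_def matrix_inv_def by (metis (mono_tags, lifting) someI_ex)+

lemma matrix_add_rdistrib: "(A + B) ** C = A ** C + (B ** C :: 'a::semiring_1^'k^'m)"
  by (simp add: matrix_matrix_mult_def vec_eq_iff distrib_right sum.distrib)

lemma trace_sum: "trace (\<Sum>i\<in>I. f i) = (\<Sum>i\<in>I. trace (f i :: real^'m^'m))"
  unfolding trace_def by (simp add: sum.swap[of _ I])

lemma trace_transpose: "trace (transpose A) = trace (A :: real^'m^'m)"
  by (simp add: trace_def transpose_def)

lemma transpose_add: "transpose (A + B) = transpose A + transpose (B :: real^'m^'k)"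
  by (simp add: transpose_def vec_eq_iff)

lemma transpose_sum: "transpose (\<Sum>i\<in>I. f i) = (\<Sum>i\<in>I. transpose (f i :: real^'m^'k))"
  by (simp add: transpose_def vec_eq_iff)

lemma matrix_mul_sum_right: "A ** (\<Sum>i\<in>I. f i) = (\<Sum>i\<in>I. A ** (f i :: real^'k^'m))"
  by (induction I rule: infinite_finite_induct) (auto simp: matrix_add_ldistrib)

lemma sum_matrix_vector_mult:
  "(\<Sum>i\<in>I. f i) *v v = (\<Sum>i\<in>I. (f i :: real^'m^'k) *v v)"
  by (induction I rule: infinite_finite_induct) (auto simp: matrix_vector_mult_add_rdistrib)

text \<open>Linearity in the middle factor lets an expectation pass through this functional. With
  \<open>trace_sandwich_outer_product\<close> it turns a cross-covariance matrix into the
  expectation of an inner product of two transformed vectors.\<close>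

lemma linear_trace_sandwich:
  "linear (\<lambda>X. trace ((A :: real^'m^'k) ** X ** transpose (B :: real^'l^'k)))"
proof (rule linearI)
  show "trace (A ** (X + Y) ** transpose B) =
      trace (A ** X ** transpose B) + trace (A ** Y ** transpose B)" for X Y
    by (simp add: matrix_add_ldistrib matrix_add_rdistrib trace_add)
  show "trace (A ** (c *\<^sub>R X) ** transpose B) = c *\<^sub>R trace (A ** X ** transpose B)" for c X
    by (simp add: trace_def matrix_matrix_mult_def sum_distrib_left sum_distrib_right mult_ac)
qed

text \<open>The sandwiched matrix is the outer product of \<open>A *v u\<close> and
  \<open>B *v v\<close>, and the trace of an outer product is the inner product of its
  factors.\<close>

lemma trace_sandwich_outer_product:
  "trace (A ** outer_product u v ** transpose B) = (A *v u) \<bullet> (B *v v)"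
  unfolding trace_def matrix_matrix_mult_def matrix_vector_mult_def outer_product_def
    transpose_def inner_vec_def
  apply (simp add: sum_distrib_left sum_distrib_right mult_ac)
  apply (rule sum.cong[OF refl], subst sum.swap, rule refl)
  done

text \<open>The diagonal entries of the sandwich are the quadratic form of \<open>S\<close> at the
  rows of \<open>A\<close>; positive semidefiniteness of \<open>S\<close> will thus bound the trace
  below by 0.\<close>

lemma trace_sandwich_eq_sum_rows:
  "trace (A ** S ** transpose A) = (\<Sum>k\<in>UNIV. (A $ k) \<bullet> (S *v (A $ k)))"
  apply (simp add: trace_def matrix_matrix_mult_def matrix_vector_mult_def
      transpose_def inner_vec_def sum_distrib_left sum_distrib_right mult_ac)
  apply (rule sum.cong[OF refl], subst sum.swap, simp add: mult_ac)
  done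

lemma linear_quadratic_form: "linear (\<lambda>X :: real^'m^'m. v \<bullet> (X *v v))"
  by (rule linearI)
    (simp_all add: matrix_vector_mult_add_rdistrib inner_add_right flip: scaleR_matrix_vector_assoc)

lemma linear_transpose: "linear (transpose :: real^'m^'k \<Rightarrow> real^'k^'m)"
  by (rule linearI) (simp_all add: transpose_def vec_eq_iff)

lemma quadratic_form_outer_product: "v \<bullet> (outer_product u u *v v) = (u \<bullet> v)\<^sup>2"
  by (simp add: matrix_vector_mult_def outer_product_def inner_vec_def power2_eq_square
      sum_distrib_left sum_distrib_right mult_ac)

text \<open>In finite dimension a linear map is bounded, so it commutes with the Bochner integral.
  It is applied to quadratic forms, to transposition and to the trace sandwich.\<close>

lemma has_cross_covariance_linear_image:
  assumes "linear L" and "has_cross_covariance M v w C"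
  shows "has_bochner_integral M
    (\<lambda>\<omega>. L (outer_product (v \<omega> - integral\<^sup>L M v) (w \<omega> - integral\<^sup>L M w))) (L C)"
  using has_bochner_integral_bounded_linear[OF linear_conv_bounded_linear[THEN iffD1, OF assms(1)]]
    assms(2) unfolding has_cross_covariance_def by blast

text \<open>The quadratic form at \<open>v\<close> is the variance of the scalar variable
  \<open>x \<omega> \<bullet> v\<close>, the expectation of a square.\<close>

lemma has_covariance_nonneg:
  assumes "has_covariance M x S"
  shows "0 \<le> v \<bullet> (S *v v)"
proof -
  have "has_bochner_integral M (\<lambda>\<omega>. ((x \<omega> - integral\<^sup>L M x) \<bullet> v)\<^sup>2) (v \<bullet> (S *v v))"
    using has_cross_covariance_linear_image[OF linear_quadratic_form[of v], of M x x S] assms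
    unfolding has_covariance_def by (simp add: quadratic_form_outer_product)
  from has_bochner_integral_integral_eq[OF this, symmetric] show ?thesis
    by simp
qed

text \<open>The integrand is symmetric at every point, so \<open>S\<close> and its transpose are
  both its integral; the integral is unique.\<close>

lemma has_covariance_symmetric:
  assumes "has_covariance M x S"
  shows "transpose S = S"
proof -
  have [simp]: "transpose (outer_product u u) = outer_product u u" for u :: "real^'b"
    by (simp add: transpose_def outer_product_def vec_eq_iff mult.commute)
  have cov: "has_cross_covariance M x x S"
    using assms by (simp only: has_covariance_def)
  have "has_cross_covariance M x x (transpose S)"
    using has_cross_covariance_linear_image[OF linear_transpose cov]
    by (simp add: has_cross_covariance_def)
  then show ?thesis
    using cov unfolding has_cross_covariance_def by (rule has_bochner_integral_eq)
qed

text \<open>A zero of a nonnegative quadratic form is a minimum, so its gradient, a multiple of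
  \<open>S *v v\<close>, vanishes there. Concretely, a small step from \<open>v\<close> against
  \<open>z = S *v v\<close> would make the form negative unless \<open>z = 0\<close>.\<close>

lemma psd_quadratic_form_eq_0:
  fixes S :: "real^'m^'m"
  assumes sym: "transpose S = S" and psd: "\<And>v. 0 \<le> v \<bullet> (S *v v)" and 0: "v \<bullet> (S *v v) = 0"
  shows "S *v v = 0"
proof -
  define z where "z = S *v v"
  define a where "a = z \<bullet> z"
  define c where "c = z \<bullet> (S *v z)"
  \<comment> \<open>The best step length would be \<open>a / c\<close>; the denominator
    \<open>c + 1\<close> also covers \<open>c = 0\<close> and still makes the value negative when
    \<open>a\<close> is nonzero.\<close>
  define t where "t = a / (c + 1)"
  have c: "0 \<le> c" unfolding c_def by (rule psd)
  have swap: "v \<bullet> (S *v z) = a"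
    unfolding a_def z_def by (metis dot_lmul_matrix sym transpose_matrix_vector)
  have "0 \<le> (v - t *\<^sub>R z) \<bullet> (S *v (v - t *\<^sub>R z))" by (rule psd)
  also have "\<dots> = t\<^sup>2 * c - 2 * t * a"
    using 0 swap
    by (simp add: matrix_vector_mult_diff_distrib matrix_vector_mult_scaleR inner_diff_left
        inner_diff_right c_def[symmetric] z_def[symmetric] a_def[symmetric] power2_eq_square
        inner_commute algebra_simps)
  also have "\<dots> = - (a\<^sup>2 * (c + 2) / (c + 1)\<^sup>2)"
  proof -
    have a: "a = t * (c + 1)" using c by (simp add: t_def)
    have "(t\<^sup>2 * c - 2 * t * a) * (c + 1)\<^sup>2 = - (a\<^sup>2 * (c + 2))"
      unfolding a by (simp add: power2_eq_square algebra_simps)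
    moreover have "(c + 1)\<^sup>2 \<noteq> 0" using c by simp
    ultimately show ?thesis by (metis minus_divide_left nonzero_eq_divide_eq)
  qed
  finally have "a\<^sup>2 * (c + 2) \<le> 0"
    using c by (simp add: divide_le_0_iff)
  then have "a = 0"
    using c by (simp add: mult_le_0_iff)
  then show ?thesis by (simp add: a_def z_def)
qed

text \<open>It suffices that the kernel is trivial. If the sum annihilates \<open>w\<close>, the
  quadratic forms of the inverses at \<open>w\<close> are nonnegative and add up to 0, so each one
  is 0; a single index then forces \<open>w = 0\<close>.\<close>

lemma invertible_sum_inverse_psd:
  fixes S :: "'i \<Rightarrow> real^'m^'m"
  assumes "finite I" "I \<noteq> {}"
    and sym: "\<And>i. i \<in> I \<Longrightarrow> transpose (S i) = S i"
    and psd: "\<And>i v. i \<in> I \<Longrightarrow> 0 \<le> v \<bullet> (S i *v v)"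
    and inv: "\<And>i. i \<in> I \<Longrightarrow> invertible (S i)"
  shows "invertible (\<Sum>i\<in>I. matrix_inv (S i))"
proof -
  let ?P = "\<Sum>i\<in>I. matrix_inv (S i)"
  have "w = 0" if w: "?P *v w = 0" for w
  proof -
    \<comment> \<open>This substitution rewrites the form of the inverse at \<open>w\<close> as the
      form of \<open>S i\<close> at \<open>V i\<close>, so the hypotheses on \<open>S i\<close>
      apply directly.\<close>
    define V where "V i = matrix_inv (S i) *v w" for i
    have SV: "S i *v V i = w" if "i \<in> I" for i
      by (simp add: V_def matrix_vector_mul_assoc matrix_inv_right inv that)
    have "(\<Sum>i\<in>I. w \<bullet> V i) = 0"
      using w by (simp only: V_def sum_matrix_vector_mult flip: inner_sum_right) simp
    moreover have nn: "0 \<le> w \<bullet> V i" if "i \<in> I" for i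
      using psd[OF that, of "V i"] SV[OF that] by (simp add: inner_commute)
    ultimately have z: "\<And>i. i \<in> I \<Longrightarrow> w \<bullet> V i = 0"
      using \<open>finite I\<close> by (simp add: sum_nonneg_eq_0_iff)
    obtain i where i: "i \<in> I" using \<open>I \<noteq> {}\<close> by blast
    have "S i *v V i = 0"
      using psd_quadratic_form_eq_0[OF sym[OF i] psd[OF i], of "V i"] z[OF i] SV[OF i]
      by (simp add: inner_commute)
    then show "w = 0" using SV[OF i] by simp
  qed
  then show ?thesis
    unfolding invertible_left_inverse matrix_left_invertible_ker by blast
qed

text \<open>The squared norm of the centered estimator expands into a double sum of inner products.
  Each has an expectation given by a cross-covariance, and those with \<open>i \<noteq> j\<close>
  vanish.\<close>

lemma MSE_linear_estimator:
  fixes x :: "nat \<Rightarrow> 'a \<Rightarrow> real^'m"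
  assumes int: "\<And>i. i \<in> {1..n} \<Longrightarrow> integrable M (x i)"
    and cov: "\<And>i. i \<in> {1..n} \<Longrightarrow> has_covariance M (x i) (S i)"
    and unc: "pairwise (\<lambda>i j. uncorrelated M (x i) (x j)) {1..n}"
  shows "MSE M (linear_estimator n A x) = (\<Sum>i=1..n. trace (A i ** S i ** transpose (A i)))"
proof -
  let ?u = "\<lambda>i \<omega>. x i \<omega> - integral\<^sup>L M (x i)"
  \<comment> \<open>One family of matrices encodes the covariances and the uncorrelatedness
    together, so the double sum is integrated without splitting off its diagonal.\<close>
  let ?C = "\<lambda>i j. if i = j then S i else 0"
  have "has_bochner_integral M (linear_estimator n A x) (\<Sum>i=1..n. A i *v integral\<^sup>L M (x i))"
    unfolding linear_estimator_def
    by (intro has_bochner_integral_sum has_bochner_integral_bounded_linear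
        [OF matrix_vector_mul_bounded_linear] has_bochner_integral_integrable int)
  then have mean: "integral\<^sup>L M (linear_estimator n A x) = (\<Sum>i=1..n. A i *v integral\<^sup>L M (x i))"
    by (rule has_bochner_integral_integral_eq)
  have centered: "linear_estimator n A x \<omega> - integral\<^sup>L M (linear_estimator n A x) =
      (\<Sum>i=1..n. A i *v ?u i \<omega>)" for \<omega>
    by (simp add: mean linear_estimator_def matrix_vector_mult_diff_distrib sum_subtractf)
  have cross: "has_cross_covariance M (x i) (x j) (?C i j)" if "i \<in> {1..n}" "j \<in> {1..n}" for i j
    using cov[OF that(1)] unc that
    by (auto simp: has_covariance_def uncorrelated_def pairwise_def)
  have "has_bochner_integral M (\<lambda>\<omega>. \<Sum>i=1..n. \<Sum>j=1..n. (A i *v ?u i \<omega>) \<bullet> (A j *v ?u j \<omega>))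
      (\<Sum>i=1..n. \<Sum>j=1..n. trace (A i ** ?C i j ** transpose (A j)))"
    using has_cross_covariance_linear_image[OF linear_trace_sandwich cross]
    unfolding trace_sandwich_outer_product by (intro has_bochner_integral_sum)
  then have "MSE M (linear_estimator n A x) =
      (\<Sum>i=1..n. \<Sum>j=1..n. trace (A i ** ?C i j ** transpose (A j)))"
    unfolding MSE_def centered inner_sum_left unfolding inner_sum_right
    by (rule has_bochner_integral_integral_eq)
  also have "\<dots> = (\<Sum>i=1..n. \<Sum>j=1..n. if i = j then trace (A i ** S i ** transpose (A j)) else 0)"
    by (intro sum.cong refl) (auto simp: trace_def)
  finally show ?thesis by simp
qed

text \<open>The two mixed terms are transposes of each other because \<open>S\<close> is symmetric,
  hence they have equal traces.\<close>

lemma trace_sandwich_add: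
  fixes S :: "real^'m^'m" and B D :: "real^'m^'k"
  assumes "transpose S = S"
  shows "trace ((B + D) ** S ** transpose (B + D)) =
    trace (B ** S ** transpose B) + 2 * trace (B ** S ** transpose D) + trace (D ** S ** transpose D)"
proof -
  have "trace (D ** S ** transpose B) = trace (transpose (D ** S ** transpose B))"
    by (simp only: trace_transpose)
  also have "\<dots> = trace (B ** S ** transpose D)"
    by (simp add: matrix_transpose_mul assms matrix_mul_assoc)
  finally show ?thesis
    by (simp add: transpose_add matrix_add_ldistrib matrix_add_rdistrib trace_add)
qed

theorem theorem4p1:
  fixes M :: "'a measure"
    and n :: nat
    and x :: "nat \<Rightarrow> 'a \<Rightarrow> real ^ 'm"
    and \<mu> :: "nat \<Rightarrow> real ^ 'm"
    and \<Sigma> :: "nat \<Rightarrow> real ^ 'm ^ 'm"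
    and A\<^sub>0 :: "nat \<Rightarrow> real ^ 'm ^ 'm"
  assumes "prob_space M"
    and "n \<ge> 1"
    and "\<And>i. i \<in> {1..n} \<Longrightarrow> has_mean M (x i) (\<mu> i)"
    and "\<And>i. i \<in> {1..n} \<Longrightarrow> has_covariance M (x i) (\<Sigma> i)"
    and "\<And>i. i \<in> {1..n} \<Longrightarrow> invertible (\<Sigma> i)"
    and "pairwise (\<lambda>i j. uncorrelated M (x i) (x j)) {1..n}"
    and "\<And>i. i \<in> {1..n} \<Longrightarrow>
          A\<^sub>0 i = matrix_inv (\<Sum>j=1..n. matrix_inv (\<Sigma> j)) ** matrix_inv (\<Sigma> i)"
  shows "invertible (\<Sum>j=1..n. matrix_inv (\<Sigma> j)) \<and>
    is_arg_min (\<lambda>A. MSE M (linear_estimator n A x)) (\<lambda>A. (\<Sum>i=1..n. A i) = mat 1) A\<^sub>0"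
proof -
  let ?P = "\<Sum>j=1..n. matrix_inv (\<Sigma> j)"
  let ?mse = "\<lambda>A. MSE M (linear_estimator n A x)"
  have int: "integrable M (x i)" if "i \<in> {1..n}" for i
    using assms(3)[OF that] by (auto simp: has_mean_def has_bochner_integral_iff)
  have sym: "transpose (\<Sigma> i) = \<Sigma> i" if "i \<in> {1..n}" for i
    using has_covariance_symmetric assms(4) that by blast
  have psd: "0 \<le> v \<bullet> (\<Sigma> i *v v)" if "i \<in> {1..n}" for i v
    using has_covariance_nonneg assms(4) that by blast
  \<comment> \<open>Only now is \<open>matrix_inv ?P\<close> known to be a genuine inverse, which
    both feasibility and optimality of the candidate rely on.\<close>
  have P: "invertible ?P"
    by (rule invertible_sum_inverse_psd) (use assms(2,5) sym psd in auto)
  have mse: "?mse A = (\<Sum>i=1..n. trace (A i ** \<Sigma> i ** transpose (A i)))" for A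
    by (rule MSE_linear_estimator) (use assms(4,6) int in auto)
  have feasible: "(\<Sum>i=1..n. A\<^sub>0 i) = mat 1"
  proof -
    have "(\<Sum>i=1..n. A\<^sub>0 i) = matrix_inv ?P ** ?P"
      using assms(7) by (simp add: matrix_mul_sum_right)
    also have "\<dots> = mat 1" by (rule matrix_inv_left[OF P])
    finally show ?thesis .
  qed
  have "?mse A\<^sub>0 \<le> ?mse A" if A: "(\<Sum>i=1..n. A i) = mat 1" for A
  proof -
    define D where "D i = A i - A\<^sub>0 i" for i
    \<comment> \<open>This is the Lagrange condition: the gradient of the objective in the i-th
      matrix is twice this product, and under the sum constraint it must not depend on the
      index.\<close>
    have "A\<^sub>0 i ** \<Sigma> i = matrix_inv ?P" if "i \<in> {1..n}" for i
      using assms(5,7) that by (simp add: matrix_inv_left flip: matrix_mul_assoc)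
    then have "(\<Sum>i=1..n. trace (A\<^sub>0 i ** \<Sigma> i ** transpose (D i))) =
        trace (matrix_inv ?P ** transpose (\<Sum>i=1..n. D i))"
      by (simp add: trace_sum transpose_sum matrix_mul_sum_right)
    also have "(\<Sum>i=1..n. D i) = 0"
      using A feasible by (simp only: D_def sum_subtractf diff_self)
    finally have linear_term: "(\<Sum>i=1..n. trace (A\<^sub>0 i ** \<Sigma> i ** transpose (D i))) = 0"
      by (simp add: trace_def transpose_def matrix_matrix_mult_def)
    have "?mse A = (\<Sum>i=1..n. trace ((A\<^sub>0 i + D i) ** \<Sigma> i ** transpose (A\<^sub>0 i + D i)))"
      by (simp add: mse D_def)
    also have "\<dots> = (\<Sum>i=1..n. trace (A\<^sub>0 i ** \<Sigma> i ** transpose (A\<^sub>0 i)) +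
        2 * trace (A\<^sub>0 i ** \<Sigma> i ** transpose (D i)) + trace (D i ** \<Sigma> i ** transpose (D i)))"
      by (intro sum.cong refl trace_sandwich_add sym)
    also have "\<dots> = ?mse A\<^sub>0 + (\<Sum>i=1..n. trace (D i ** \<Sigma> i ** transpose (D i)))"
      using linear_term by (simp add: mse sum.distrib flip: sum_distrib_left)
    also have "\<dots> \<ge> ?mse A\<^sub>0"
      using psd by (auto simp: trace_sandwich_eq_sum_rows intro!: sum_nonneg)
    finally show ?thesis .
  qed
  \<comment> \<open>\<open>is_arg_min\<close> asks that no feasible point has a strictly smaller
    value, which follows from the inequality just shown by linearity of the order.\<close>
  with P feasible show ?thesis
    unfolding is_arg_min_def by (blast dest: leD)
qed

end
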